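(* For every wheel-graph instance (any $n\ge4$ and $\mu\in(0,1)$), the optimal value of the relaxed master problem RMP augmented with any collection of fewer than $n$ P-cuts and S-cuts is strictly less than $Z^*$, the optimal value of the VRPSD instance under the optimal restocking policy.
   Context: **Wheel-graph instance.** Customers $N=\{1,\dots,n\}$, $n\ge4$, depot $0$. Let $E_1=\{\{k,k+1\}:1\le k\le n-1\}\cup\{\{n,1\}\}$ and $E_2=E(N)\setminus E_1$, where $E(S)$ denotes all edges with both endpoints in $S$. Costs: $c_{0,i}=1$; $c_{i,j}=1$ if $\{i,j\}\in E_1$, $c_{i,j}=2$ if $\{i,j\}\in E_2$. Demands $\xi_i\sim\text{Bern}(\mu)$ are independent, $\mu\in(0,1)$. Capacity $Q=n-1$. Exactly one route is used ($M=\{1\}$), with load factor $f\ge n\mu/Q$, so feasible solutions $x$ are exactly the edge-multiplicity vectors of routes $(0,p,0)$ with $p$ a permutation of $N$. Penalties $b^F=b^P=0$: failure cost $c^F_i=2$, preventive return cost $c^P_{i,j}=2-c_{i,j}$ for customers $i\neq j$, and $c^P_{0,j}=0$. **OR recourse.** Let $\Psi(s,q)=\max\{\lceil(s-q)/Q\rceil,0\}$. For a path (nonempty sequence of distinct customers) $p=(i_1,\dots,i_t)$ with customer set $N(p)$, $i_0=0$, $q\in\{0,\dots,Q\}$: $F^p_{i_t}(q)=0$ and for $j<t$, $F^p_{i_j}(q)=\min\{H^p_{i_{j+1}}(q),c^P_{i_j,i_{j+1}}+H^p_{i_{j+1}}(Q)\}$ with $H^p_{i}(q)=\mathbb{E}[c^F_i\Psi(\xi_i,q)+F^p_i(\Psi(\xi_i,q)Q+q-\xi_i)]$.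 $\mathcal{Q}^{\text{OR}}_p$ is the minimum of $F^p_{i_0}(Q)$ over $p$ and its reversal. $Z^*$ is the minimum over feasible $x$, with route $(0,p,0)$, of $\sum_ec_ex_e+\mathcal{Q}^{\text{OR}}_p$. **RMP.** Minimize $\sum_ec_ex_e+\sum_{i\in N}\theta_i$ over feasible (integer) $x$ and $\theta\in\mathbb{R}^N_{\ge0}$. **P-cuts and S-cuts.** All paths are feasible here. The P-cut of a path $p=(i_1,\dots,i_t)$ is $\sum_{i\in N(p)}\theta_i\ge\mathcal{Q}^{\text{OR}}_p(\sum_{j=1}^{t-1}x_{\{i_j,i_{j+1}\}}-|N(p)|+2)$. For nonempty $S\subseteq N$, let $\Pi(S,m)$ be the set of all sets of $m$ feasible paths whose customer sets partition $S$, $m(S)=\min\{m:\Pi(S,m)\neq\emptyset\}$ (here $m(S)=1$), $\mathcal{L}(S,m)=\min_{\pi\in\Pi(S,m)}\sum_{p\in\pi}\mathcal{Q}^{\text{OR}}_p$. An S-cut of $S$ is $\sum_{i\in S}\theta_i\ge\mathcal{L}_S(\sum_{e\in E(S)}x_e-|S|+m_S+1)$ with integer $1\le m_S\le m(S)$ and $0\le\mathcal{L}_S\le\mathcal{L}(S,m_S)$. *)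

theory Defs
  imports "HOL-Probability.Probability" "HOL-Probability.Product_PMF" "HOL-Library.Disjoint_Sets"
begin

section \<open>Wheel-graph instances\<close>

text \<open>Vertices are natural numbers: the depot is 0 and the customers are 1, ..., n. An edge is a
  two-element set of vertices. Parameters: n is the number of customers, \<mu> the demand probability,
  f the load factor.\<close>

definition customers :: "nat \<Rightarrow> nat set" where
  "customers n = {1..n}"

definition edges_in :: "nat set \<Rightarrow> nat set set" where
  "edges_in S = {{i, j} | i j. i \<in> S \<and> j \<in> S \<and> i \<noteq> j}"

definition all_edges :: "nat \<Rightarrow> nat set set" where
  "all_edges n = edges_in (insert 0 (customers n))"

definition rim_edges :: "nat \<Rightarrow> nat set set" where
  "rim_edges n = {{k, k + 1} | k. 1 \<le> k \<and> k \<le> n - 1} \<union> {{n, 1}}"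

definition edge_cost :: "nat \<Rightarrow> nat set \<Rightarrow> real" where
  "edge_cost n e = (if 0 \<in> e then 1 else if e \<in> rim_edges n then 1 else 2)"

definition capacity :: "nat \<Rightarrow> int" where
  "capacity n = int n - 1"

definition failure_cost :: "nat \<Rightarrow> real" where
  "failure_cost i = 2"

definition preventive_cost :: "nat \<Rightarrow> nat \<Rightarrow> nat \<Rightarrow> real" where
  "preventive_cost n i j = (if i = 0 then 0 else 2 - edge_cost n {i, j})"

text \<open>Joint law of the demand vector: independent Bernoulli demands, 0 outside the customers.\<close>

definition demands :: "nat \<Rightarrow> real \<Rightarrow> (nat \<Rightarrow> int) pmf" where
  "demands n \<mu> = Pi_pmf (customers n) 0 (\<lambda>_. map_pmf of_bool (bernoulli_pmf \<mu>))"


section \<open>Paths and routes\<close>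

definition feasible_path :: "nat \<Rightarrow> real \<Rightarrow> real \<Rightarrow> nat list \<Rightarrow> bool" where
  "feasible_path n \<mu> f p \<longleftrightarrow> p \<noteq> [] \<and> distinct p \<and> set p \<subseteq> customers n \<and>
     measure_pmf.expectation (demands n \<mu>) (\<lambda>\<xi>. real_of_int (\<Sum>i\<in>set p. \<xi> i))
       \<le> f * real_of_int (capacity n)"

definition feasible_routes :: "nat \<Rightarrow> real \<Rightarrow> real \<Rightarrow> nat list set" where
  "feasible_routes n \<mu> f = {p. feasible_path n \<mu> f p \<and> set p = customers n}"

definition edge_multiplicity :: "nat list \<Rightarrow> nat set \<Rightarrow> nat" where
  "edge_multiplicity p e =
     (let w = 0 # p @ [0] in card {k. k + 1 < length w \<and> {w ! k, w ! (k + 1)} = e})"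

definition feasible_solutions :: "nat \<Rightarrow> real \<Rightarrow> real \<Rightarrow> (nat set \<Rightarrow> nat) set" where
  "feasible_solutions n \<mu> f = edge_multiplicity ` feasible_routes n \<mu> f"

definition travel_cost :: "nat \<Rightarrow> (nat set \<Rightarrow> nat) \<Rightarrow> real" where
  "travel_cost n x = (\<Sum>e\<in>all_edges n. edge_cost n e * real (x e))"


section \<open>Recourse under the optimal restocking policy\<close>

definition failures :: "nat \<Rightarrow> int \<Rightarrow> int \<Rightarrow> int" where
  "failures n s q = max \<lceil>real_of_int (s - q) / real_of_int (capacity n)\<rceil> 0"

text \<open>Expected cost of serving customer i with residual capacity q on arrival, when G is the
  expected cost incurred after i as a function of the residual capacity on leaving i.\<close>

definition service_cost :: "nat \<Rightarrow> real \<Rightarrow> (int \<Rightarrow> real) \<Rightarrow> nat \<Rightarrow> int \<Rightarrow> real" where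
  "service_cost n \<mu> G i q = measure_pmf.expectation (demands n \<mu>)
     (\<lambda>\<xi>. failure_cost i * real_of_int (failures n (\<xi> i) q)
           + G (failures n (\<xi> i) q * capacity n + q - \<xi> i))"

text \<open>The cost-to-go depends on a path only through the part still to be visited: in
  \<^term>\<open>cost_to_go n \<mu> r i q\<close>, r lists the customers remaining after vertex i.\<close>

primrec cost_to_go :: "nat \<Rightarrow> real \<Rightarrow> nat list \<Rightarrow> nat \<Rightarrow> int \<Rightarrow> real" where
  "cost_to_go n \<mu> [] = (\<lambda>i q. 0)"
| "cost_to_go n \<mu> (j # r) = (\<lambda>i q.
     min (service_cost n \<mu> (cost_to_go n \<mu> r j) j q)
         (preventive_cost n i j + service_cost n \<mu> (cost_to_go n \<mu> r j) j (capacity n)))"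

definition recourse_OR :: "nat \<Rightarrow> real \<Rightarrow> nat list \<Rightarrow> real" where
  "recourse_OR n \<mu> p =
     min (cost_to_go n \<mu> p 0 (capacity n)) (cost_to_go n \<mu> (rev p) 0 (capacity n))"

definition optimal_value :: "nat \<Rightarrow> real \<Rightarrow> real \<Rightarrow> real" where
  "optimal_value n \<mu> f =
     Min ((\<lambda>p. travel_cost n (edge_multiplicity p) + recourse_OR n \<mu> p) ` feasible_routes n \<mu> f)"


section \<open>P-cuts and S-cuts\<close>

definition path_partitions ::
  "nat \<Rightarrow> real \<Rightarrow> real \<Rightarrow> nat set \<Rightarrow> nat \<Rightarrow> nat list set set" where
  "path_partitions n \<mu> f S m = {P. finite P \<and> card P = m \<and> (\<forall>p\<in>P. feasible_path n \<mu> f p) \<and>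
     disjoint_family_on set P \<and> (\<Union>p\<in>P. set p) = S}"

definition min_paths :: "nat \<Rightarrow> real \<Rightarrow> real \<Rightarrow> nat set \<Rightarrow> nat" where
  "min_paths n \<mu> f S = (LEAST m. path_partitions n \<mu> f S m \<noteq> {})"

definition recourse_bound :: "nat \<Rightarrow> real \<Rightarrow> real \<Rightarrow> nat set \<Rightarrow> nat \<Rightarrow> real" where
  "recourse_bound n \<mu> f S m =
     Min ((\<lambda>P. \<Sum>p\<in>P. recourse_OR n \<mu> p) ` path_partitions n \<mu> f S m)"

text \<open>A P-cut is given by its path; an S-cut by the customer set S, the coefficient
  \<open>\<L>\<^sub>S\<close> and the integer \<open>m\<^sub>S\<close>.\<close>

datatype cut = P_cut "nat list" | S_cut "nat set" real nat

fun valid_cut :: "nat \<Rightarrow> real \<Rightarrow> real \<Rightarrow> cut \<Rightarrow> bool" where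
  "valid_cut n \<mu> f (P_cut p) \<longleftrightarrow> feasible_path n \<mu> f p"
| "valid_cut n \<mu> f (S_cut S L m) \<longleftrightarrow> S \<noteq> {} \<and> S \<subseteq> customers n \<and>
     1 \<le> m \<and> m \<le> min_paths n \<mu> f S \<and> 0 \<le> L \<and> L \<le> recourse_bound n \<mu> f S m"

fun satisfies_cut ::
  "nat \<Rightarrow> real \<Rightarrow> (nat set \<Rightarrow> nat) \<Rightarrow> (nat \<Rightarrow> real) \<Rightarrow> cut \<Rightarrow> bool" where
  "satisfies_cut n \<mu> x \<theta> (P_cut p) \<longleftrightarrow>
     (\<Sum>i\<in>set p. \<theta> i) \<ge> recourse_OR n \<mu> p *
       ((\<Sum>j<length p - 1. real (x {p ! j, p ! (j + 1)})) - real (card (set p)) + 2)"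
| "satisfies_cut n \<mu> x \<theta> (S_cut S L m) \<longleftrightarrow>
     (\<Sum>i\<in>S. \<theta> i) \<ge> L * ((\<Sum>e\<in>edges_in S. real (x e)) - real (card S) + real m + 1)"


section \<open>Relaxed master problem\<close>

definition RMP_feasible ::
  "nat \<Rightarrow> real \<Rightarrow> real \<Rightarrow> cut set \<Rightarrow> ((nat set \<Rightarrow> nat) \<times> (nat \<Rightarrow> real)) set" where
  "RMP_feasible n \<mu> f C = {(x, \<theta>). x \<in> feasible_solutions n \<mu> f \<and>
     (\<forall>i\<in>customers n. \<theta> i \<ge> 0) \<and> (\<forall>c\<in>C. satisfies_cut n \<mu> x \<theta> c)}"

text \<open>Extended reals are used so that an infeasible program would have value \<open>\<infinity>\<close>.\<close>

definition RMP_value :: "nat \<Rightarrow> real \<Rightarrow> real \<Rightarrow> cut set \<Rightarrow> ereal" where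
  "RMP_value n \<mu> f C =
     (INF (x, \<theta>)\<in>RMP_feasible n \<mu> f C. ereal (travel_cost n x + (\<Sum>i\<in>customers n. \<theta> i)))"

end

theory Submission
  imports Defs
begin

text \<open>Demand can exceed the capacity only if all n customers are served by one path and each has
  demand 1, and restocking along an edge outside the rim is free. So the only paths with positive
  recourse are the Hamiltonian paths of the rim. Hence every S-cut is void, its coefficient being
  0, and \<open>Z\<^sup>* > n + 1\<close>, as a route leaving the rim costs at least n + 2. A Hamiltonian path of the
  rim is determined by the rim edge that it misses, and the P-cut of one such path is void at all
  the others. Fewer than n cuts therefore leave some Hamiltonian rim path with \<open>\<theta> = 0\<close> feasible,
  at cost n + 1.\<close>

section \<open>Demands\<close>

lemma finite_customers [simp]: "finite (customers n)"
  by (simp add: customers_def)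

lemma card_customers [simp]: "card (customers n) = n"
  by (simp add: customers_def)

text \<open>The recourse recursion only ever averages over the demand of the customer being served,
  so the joint law enters through its Bernoulli marginal alone and every expectation becomes a
  two-point average.\<close>

lemma expectation_demand:
  fixes g :: "int \<Rightarrow> real"
  assumes "i \<in> customers n" "0 < \<mu>" "\<mu> < 1"
  shows "measure_pmf.expectation (demands n \<mu>) (\<lambda>\<xi>. g (\<xi> i)) = \<mu> * g 1 + (1 - \<mu>) * g 0"
proof -
  have "map_pmf (\<lambda>\<xi>. \<xi> i) (demands n \<mu>) = map_pmf of_bool (bernoulli_pmf \<mu>)"
    unfolding demands_def by (rule trans[OF Pi_pmf_component]) (use assms in simp_all)
  moreover have "measure_pmf.expectation (demands n \<mu>) (\<lambda>\<xi>. g (\<xi> i))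
      = measure_pmf.expectation (map_pmf (\<lambda>\<xi>. \<xi> i) (demands n \<mu>)) g"
    by simp
  ultimately show ?thesis
    using assms by simp
qed

lemma expectation_total_demand:
  assumes "S \<subseteq> customers n" "0 < \<mu>" "\<mu> < 1"
  shows "measure_pmf.expectation (demands n \<mu>) (\<lambda>\<xi>. real_of_int (\<Sum>i\<in>S. \<xi> i)) = real (card S) * \<mu>"
proof -
  \<comment> \<open>Finite support makes every coordinate integrable, which linearity of the
    expectation requires.\<close>
  have "finite (set_pmf (demands n \<mu>))"
    unfolding demands_def by (subst set_Pi_pmf) (auto intro!: finite_PiE_dflt)
  then have "measure_pmf.expectation (demands n \<mu>) (\<lambda>\<xi>. real_of_int (\<Sum>i\<in>S. \<xi> i))
      = (\<Sum>i\<in>S. measure_pmf.expectation (demands n \<mu>) (\<lambda>\<xi>. real_of_int (\<xi> i)))"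
    by (simp add: Bochner_Integration.integral_sum integrable_measure_pmf_finite)
  also have "\<dots> = (\<Sum>i\<in>S. \<mu>)"
    using assms expectation_demand[where g = real_of_int] by (intro sum.cong) auto
  finally show ?thesis
    by simp
qed

text \<open>The load factor admits the expected demand of all \<open>n\<close> customers, and fewer
  customers have a smaller expected demand. This makes \<open>min_paths\<close> equal to 1 for
  S-cuts.\<close>

lemma feasible_pathI:
  assumes "n \<ge> 4" "0 < \<mu>" "\<mu> < 1" "f \<ge> real n * \<mu> / real_of_int (capacity n)"
    and "p \<noteq> []" "distinct p" "set p \<subseteq> customers n"
  shows "feasible_path n \<mu> f p"
proof -
  have "card (set p) \<le> n"
    using card_mono[OF finite_customers assms(7)] by simp
  then have "real (card (set p)) * \<mu> \<le> real n * \<mu>"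
    using assms by (intro mult_right_mono) auto
  also have "\<dots> \<le> f * real_of_int (capacity n)"
    using assms by (simp add: capacity_def field_simps)
  finally show ?thesis
    using assms expectation_total_demand[of "set p" n \<mu>] by (simp add: feasible_path_def)
qed


section \<open>Recourse\<close>

lemma edge_cost_le: "edge_cost n e \<le> 2"
  by (simp add: edge_cost_def)

lemma preventive_cost_nonneg: "0 \<le> preventive_cost n i j"
  using edge_cost_le[of n "{i, j}"] by (simp add: preventive_cost_def)

lemma preventive_cost_pos_iff:
  assumes "i \<noteq> 0" "j \<noteq> 0"
  shows "0 < preventive_cost n i j \<longleftrightarrow> {i, j} \<in> rim_edges n"
  using assms by (simp add: preventive_cost_def edge_cost_def)

lemma service_cost_nonneg:
  assumes "\<And>q. 0 \<le> G q"
  shows "0 \<le> service_cost n \<mu> G i q"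
  unfolding service_cost_def
  by (intro Bochner_Integration.integral_nonneg)
     (auto simp: failure_cost_def failures_def intro!: add_nonneg_nonneg assms)

lemma cost_to_go_nonneg: "0 \<le> cost_to_go n \<mu> r i q"
proof (induction r arbitrary: i q)
  case (Cons j r)
  then show ?case
    using service_cost_nonneg[of "cost_to_go n \<mu> r j"] preventive_cost_nonneg[of n i j]
    by (simp add: add_nonneg_nonneg)
qed simp

lemma recourse_OR_nonneg: "0 \<le> recourse_OR n \<mu> p"
  by (simp add: recourse_OR_def cost_to_go_nonneg)

section \<open>A single service step\<close>

lemma failures_0: "n \<ge> 2 \<Longrightarrow> q \<ge> 0 \<Longrightarrow> failures n 0 q = 0"
  by (simp add: failures_def capacity_def ceiling_le_zero divide_le_0_iff)

lemma failures_1_pos: "n \<ge> 2 \<Longrightarrow> q \<ge> 1 \<Longrightarrow> failures n 1 q = 0"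
  by (simp add: failures_def capacity_def ceiling_le_zero divide_le_0_iff)

lemma failures_1_0:
  assumes "n \<ge> 2"
  shows "failures n 1 0 = 1"
proof -
  have "\<lceil>1 / (real n - 1)\<rceil> = 1"
    using assms by (intro ceiling_unique) (auto simp: field_simps)
  then show ?thesis
    using assms by (simp add: failures_def capacity_def)
qed

text \<open>One unit on board covers any Bernoulli demand, so no failure term appears.\<close>

lemma service_cost_pos_capacity:
  assumes "n \<ge> 2" "0 < \<mu>" "\<mu> < 1" "i \<in> customers n" "q \<ge> 1"
  shows "service_cost n \<mu> G i q = \<mu> * G (q - 1) + (1 - \<mu>) * G q"
  unfolding service_cost_def
  by (subst expectation_demand[where g = "\<lambda>d. failure_cost i * real_of_int (failures n d q)
        + G (failures n d q * capacity n + q - d)"])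
     (use assms in \<open>simp_all add: failures_0 failures_1_pos\<close>)

text \<open>A demand of 1 met with an empty vehicle costs one failure, worth 2; the refilled vehicle
  leaves with one unit less than full.\<close>

lemma service_cost_zero_capacity:
  assumes "n \<ge> 2" "0 < \<mu>" "\<mu> < 1" "i \<in> customers n"
  shows "service_cost n \<mu> G i 0 = \<mu> * (2 + G (capacity n - 1)) + (1 - \<mu>) * G 0"
  unfolding service_cost_def
  by (subst expectation_demand[where g = "\<lambda>d. failure_cost i * real_of_int (failures n d 0)
        + G (failures n d 0 * capacity n + 0 - d)"])
     (use assms in \<open>simp_all add: failures_0 failures_1_0 failure_cost_def\<close>)

section \<open>Paths with zero cost-to-go\<close>

lemma cost_to_go_eq_0I:
  assumes "service_cost n \<mu> (cost_to_go n \<mu> r j) j q = 0"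
  shows "cost_to_go n \<mu> (j # r) i q = 0"
  using assms cost_to_go_nonneg[of n \<mu> "j # r" i q] by (simp add: min_def split: if_splits)

text \<open>Each customer takes at most one unit, so having one unit per remaining customer is
  preserved and the vehicle never fails.\<close>

lemma cost_to_go_enough_capacity:
  assumes "n \<ge> 2" "0 < \<mu>" "\<mu> < 1" "set r \<subseteq> customers n" "int (length r) \<le> q"
  shows "cost_to_go n \<mu> r i q = 0"
  using assms(4,5)
proof (induction r arbitrary: i q)
  case (Cons j r)
  then have "service_cost n \<mu> (cost_to_go n \<mu> r j) j q = 0"
    using assms by (subst service_cost_pos_capacity) auto
  then show ?case
    by (rule cost_to_go_eq_0I)
qed simp

text \<open>The policy behind this: serve up to \<open>a\<close> from the current load, restock for
  free between \<open>a\<close> and \<open>b\<close>, and serve the rest from a full vehicle. Both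
  stretches are short enough to exclude failures.\<close>

lemma cost_to_go_free_return:
  assumes "n \<ge> 2" "0 < \<mu>" "\<mu> < 1" "set (xs @ a # b # ys) \<subseteq> customers n"
    and "preventive_cost n a b = 0" "int (length (b # ys)) \<le> capacity n"
    and "int (length (xs @ [a])) \<le> q"
  shows "cost_to_go n \<mu> (xs @ a # b # ys) i q = 0"
  using assms(4,7)
proof (induction xs arbitrary: i q)
  case Nil
  have "service_cost n \<mu> (cost_to_go n \<mu> ys b) b (capacity n) = 0"
    using assms(1-3,6) Nil.prems
    by (subst service_cost_pos_capacity) (auto simp: cost_to_go_enough_capacity)
  \<comment> \<open>The return branch of the minimum is already 0, whatever load is left after
    \<open>a\<close>.\<close>
  then have "cost_to_go n \<mu> (b # ys) a q' = 0" for q'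
    using assms(5) cost_to_go_nonneg[of n \<mu> "b # ys" a q'] by (simp add: min_def split: if_splits)
  then have "service_cost n \<mu> (cost_to_go n \<mu> (b # ys) a) a q = 0"
    using assms(1-3) Nil.prems by (subst service_cost_pos_capacity) auto
  then show ?case
    by (simp only: append_Nil cost_to_go_eq_0I)
next
  case (Cons j xs)
  then have "service_cost n \<mu> (cost_to_go n \<mu> (xs @ a # b # ys) j) j q = 0"
    using assms(1-3) by (subst service_cost_pos_capacity) auto
  then show ?case
    by (simp only: append_Cons cost_to_go_eq_0I)
qed

section \<open>Positive recourse along the rim\<close>

lemma service_cost_short_capacity_pos:
  assumes "n \<ge> 2" "0 < \<mu>" "\<mu> < 1" "j \<in> customers n"
    and "r \<noteq> [] \<Longrightarrow> 0 < cost_to_go n \<mu> r j (int (length r) - 1)"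
  shows "0 < service_cost n \<mu> (cost_to_go n \<mu> r j) j (int (length r))"
proof (cases "r = []")
  case True
  \<comment> \<open>The last customer is reached with an empty vehicle and fails with probability
    \<open>\<mu>\<close>.\<close>
  then show ?thesis
    using assms by (simp add: service_cost_zero_capacity)
next
  case False
  then have "int (length r) \<ge> 1"
    by (cases r) auto
  \<comment> \<open>With probability \<open>\<mu>\<close> one unit is used, and the load is again
    one short for the customers in \<open>r\<close>; the other outcome costs at least 0.\<close>
  then show ?thesis
    using assms False
    by (subst service_cost_pos_capacity) (auto intro!: add_pos_nonneg simp: cost_to_go_nonneg)
qed

text \<open>The invariant is a load one unit below the number of remaining customers. Going on risks
  a failure in the event that all of them have demand 1, and returning costs a positive amount on
  every edge, so both branches of the minimum are positive.\<close>

lemma cost_to_go_short_capacity_pos: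
  assumes "n \<ge> 2" "0 < \<mu>" "\<mu> < 1" "set r \<subseteq> customers n" "r \<noteq> []"
    and "successively (\<lambda>a b. 0 < preventive_cost n a b) (i # r)"
  shows "0 < cost_to_go n \<mu> r i (int (length r) - 1)"
  using assms(4-6)
proof (induction r arbitrary: i)
  case (Cons j r)
  have "0 < service_cost n \<mu> (cost_to_go n \<mu> r j) j (int (length r))"
    using assms(1-3) Cons by (intro service_cost_short_capacity_pos) auto
  moreover have "0 < preventive_cost n i j"
    using Cons.prems by simp
  moreover have "0 \<le> service_cost n \<mu> (cost_to_go n \<mu> r j) j (capacity n)"
    by (intro service_cost_nonneg cost_to_go_nonneg)
  ultimately show ?case
    by simp
qed simp

text \<open>A return at the depot is free, but there the vehicle is full anyway, so both branches
  coincide. The full load \<open>n - 1\<close> is one short of the \<open>n\<close> customers, which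
  starts the invariant.\<close>

lemma cost_to_go_rim_pos:
  assumes "n \<ge> 2" "0 < \<mu>" "\<mu> < 1" "set p \<subseteq> customers n" "length p = n"
    and "successively (\<lambda>a b. 0 < preventive_cost n a b) p"
  shows "0 < cost_to_go n \<mu> p 0 (capacity n)"
proof -
  obtain j r where p: "p = j # r"
    using assms by (cases p) auto
  have "0 < service_cost n \<mu> (cost_to_go n \<mu> r j) j (int (length r))"
    using assms p by (intro service_cost_short_capacity_pos cost_to_go_short_capacity_pos) auto
  moreover have "int (length r) = capacity n"
    using assms p by (auto simp: capacity_def)
  ultimately show ?thesis
    using p by (simp add: preventive_cost_def)
qed

lemma successively_preventive_iff_rim:
  assumes "set p \<subseteq> customers n"
  shows "successively (\<lambda>a b. 0 < preventive_cost n a b) p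
    \<longleftrightarrow> successively (\<lambda>a b. {a, b} \<in> rim_edges n) p"
proof (rule successively_cong)
  show "\<And>a b. a \<in> set p \<Longrightarrow> b \<in> set p \<Longrightarrow> (0 < preventive_cost n a b) = ({a, b} \<in> rim_edges n)"
    using assms by (intro preventive_cost_pos_iff) (auto simp: customers_def)
qed simp

text \<open>Reversal preserves rim paths because edges are undirected, so both orientations have
  positive cost.\<close>

lemma recourse_OR_rim_pos:
  assumes "n \<ge> 2" "0 < \<mu>" "\<mu> < 1" "set p \<subseteq> customers n" "length p = n"
    and "successively (\<lambda>a b. {a, b} \<in> rim_edges n) p"
  shows "0 < recourse_OR n \<mu> p"
proof -
  have "successively (\<lambda>a b. {a, b} \<in> rim_edges n) (rev p)"
    using assms(6) by (simp add: insert_commute)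
  then show ?thesis
    using assms successively_preventive_iff_rim[of p n] successively_preventive_iff_rim[of "rev p" n]
    by (simp add: recourse_OR_def cost_to_go_rim_pos)
qed

lemma recourse_OR_eq_0I:
  assumes "cost_to_go n \<mu> p 0 (capacity n) = 0"
  shows "recourse_OR n \<mu> p = 0"
  using assms cost_to_go_nonneg[of n \<mu> "rev p"] by (simp add: recourse_OR_def min_def)

lemma recourse_OR_short:
  assumes "n \<ge> 2" "0 < \<mu>" "\<mu> < 1" "set p \<subseteq> customers n" "length p < n"
  shows "recourse_OR n \<mu> p = 0"
  using assms by (intro recourse_OR_eq_0I cost_to_go_enough_capacity) (auto simp: capacity_def)

lemma not_successively_split:
  assumes "\<not> successively P p"
  obtains xs a b ys where "p = xs @ a # b # ys" "\<not> P a b"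
proof -
  have "\<exists>xs a b ys. p = xs @ a # b # ys \<and> \<not> P a b"
    using assms
  proof (induction p rule: induct_list012)
    case (3 x y zs)
    show ?case
    proof (cases "P x y")
      case True
      then obtain xs a b ys where "y # zs = xs @ a # b # ys" "\<not> P a b"
        using 3 by auto
      then have "x # y # zs = (x # xs) @ a # b # ys \<and> \<not> P a b"
        by simp
      then show ?thesis
        by blast
    next
      case False
      then have "x # y # zs = [] @ x # y # zs \<and> \<not> P x y"
        by simp
      then show ?thesis
        by blast
    qed
  qed simp_all
  then show thesis
    using that by blast
qed

text \<open>An edge of the path off the rim offers a free return. It splits the path into two
  nonempty stretches, hence each has at most \<open>n - 1\<close> customers and fits into one
  load.\<close>

lemma recourse_OR_not_rim:
  assumes "n \<ge> 2" "0 < \<mu>" "\<mu> < 1" "set p \<subseteq> customers n" "length p \<le> n"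
    and "\<not> successively (\<lambda>a b. {a, b} \<in> rim_edges n) p"
  shows "recourse_OR n \<mu> p = 0"
proof -
  obtain xs a b ys where p: "p = xs @ a # b # ys" and "\<not> 0 < preventive_cost n a b"
    using not_successively_split assms successively_preventive_iff_rim by metis
  then have "preventive_cost n a b = 0"
    using preventive_cost_nonneg[of n a b] by simp
  then show ?thesis
    using assms p unfolding p
    by (intro recourse_OR_eq_0I cost_to_go_free_return) (auto simp: capacity_def)
qed


section \<open>Edges of a path\<close>

text \<open>The depot legs are left out, since they cost the same on every route. A set suffices
  because a path of distinct customers repeats no edge.\<close>

definition path_edges :: "nat list \<Rightarrow> nat set set" where
  "path_edges p = (\<lambda>j. {p ! j, p ! (j + 1)}) ` {..<length p - 1}"

lemma path_edges_subset_iff_successively: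
  "path_edges p \<subseteq> A \<longleftrightarrow> successively (\<lambda>a b. {a, b} \<in> A) p"
  by (auto simp: path_edges_def successively_conv_nth less_diff_conv)

text \<open>If two such edges agree, their indices are equal or each is the successor of the other;
  the latter is impossible.\<close>

lemma inj_on_path_edge:
  assumes "distinct p"
  shows "inj_on (\<lambda>j. {p ! j, p ! (j + 1)}) {..<length p - 1}"
  using assms by (auto simp: inj_on_def doubleton_eq_iff nth_eq_iff_index_eq)

lemma card_path_edges: "distinct p \<Longrightarrow> card (path_edges p) = length p - 1"
  unfolding path_edges_def by (subst card_image[OF inj_on_path_edge]) simp_all

lemma nth_route:
  assumes "k \<le> length p + 1"
  shows "(0 # p @ [0]) ! k = (if k = 0 \<or> k = length p + 1 then 0 else p ! (k - 1))"
  using assms by (cases k) (auto simp: nth_append)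

lemma edge_multiplicity_alt:
  "edge_multiplicity p e
    = card {k \<in> {..length p}. {(0 # p @ [0]) ! k, (0 # p @ [0]) ! (k + 1)} = e}"
  by (auto simp: edge_multiplicity_def Let_def less_Suc_eq_le intro!: arg_cong[where f = card])

lemma edge_multiplicity_interior:
  assumes "distinct p" "0 \<notin> e"
  shows "edge_multiplicity p e = of_bool (e \<in> path_edges p)"
proof -
  let ?J = "{j \<in> {..<length p - 1}. {p ! j, p ! (j + 1)} = e}"
  \<comment> \<open>The depot in front of the route shifts indices by one. The first and last legs
    drop out because they contain 0.\<close>
  have "{k \<in> {..length p}. {(0 # p @ [0]) ! k, (0 # p @ [0]) ! (k + 1)} = e} = Suc ` ?J"
  proof (intro equalityI subsetI)
    fix k assume k: "k \<in> {k \<in> {..length p}. {(0 # p @ [0]) ! k, (0 # p @ [0]) ! (k + 1)} = e}"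
    then have "k \<noteq> 0" "k \<noteq> length p"
      using assms(2) nth_route[of "length p + 1" p] by auto
    moreover from this obtain j where "k = Suc j"
      by (cases k) auto
    ultimately show "k \<in> Suc ` ?J"
      using k by (auto simp: nth_append)
  qed (auto simp: nth_append)
  then have "edge_multiplicity p e = card ?J"
    by (simp add: edge_multiplicity_alt card_image)
  also have "\<dots> = of_bool (e \<in> path_edges p)"
  proof (cases "e \<in> path_edges p")
    case True
    then obtain j where "j \<in> ?J"
      by (auto simp: path_edges_def)
    then have "?J = {j}"
      using inj_onD[OF inj_on_path_edge[OF assms(1)]] by auto
    then show ?thesis
      using True by simp
  next
    case False
    then have "?J = {}"
      by (auto simp: path_edges_def)
    then show ?thesis
      using False by (simp only: card.empty of_bool_eq)
  qed
  finally show ?thesis .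
qed

lemma finite_edges_in: "finite S \<Longrightarrow> finite (edges_in S)"
  by (rule finite_subset[of _ "Pow S"]) (auto simp: edges_in_def)

text \<open>Counting edges with multiplicity amounts to summing over the legs of the route; the
  constant 2 comes from the two depot legs.\<close>

lemma travel_cost_route:
  assumes "distinct p" "set p = customers n" "p \<noteq> []"
  shows "travel_cost n (edge_multiplicity p) = 2 + (\<Sum>e\<in>path_edges p. edge_cost n e)"
proof -
  let ?g = "\<lambda>k. {(0 # p @ [0]) ! k, (0 # p @ [0]) ! (k + 1)}"
  have len: "length p \<noteq> 0"
    using assms by auto
  have dist: "\<And>j. Suc j < length p \<Longrightarrow> p ! j \<noteq> p ! Suc j"
    using assms(1) by (simp add: nth_eq_iff_index_eq)
  have mem: "\<And>j. j < length p \<Longrightarrow> p ! j \<in> customers n"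
    using assms(2) nth_mem by blast
  have no0: "\<And>j. j < length p \<Longrightarrow> p ! j \<noteq> 0"
    using mem by (fastforce simp: customers_def)
  \<comment> \<open>Each leg has to be a genuine edge, or the regrouping by edges would lose its
    cost.\<close>
  have "?g k \<in> all_edges n" if k: "k \<le> length p" for k
  proof -
    let ?a = "(0 # p @ [0]) ! k" and ?b = "(0 # p @ [0]) ! (k + 1)"
    have "?a \<noteq> ?b"
      using k len dist[of "k - 1"] no0[of k] no0[of "k - 1"] nth_route[of k p] nth_route[of "k + 1" p]
      by (cases "k = 0"; cases "k = length p") auto
    moreover have "?a \<in> insert 0 (customers n)" "?b \<in> insert 0 (customers n)"
      using k len mem[of k] mem[of "k - 1"] nth_route[of k p] nth_route[of "k + 1" p]
      by (auto split: if_splits)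
    ultimately show ?thesis
      unfolding all_edges_def edges_in_def by blast
  qed
  then have "(\<Sum>e\<in>all_edges n. \<Sum>k\<in>{k \<in> {..length p}. ?g k = e}. edge_cost n (?g k))
      = (\<Sum>k\<le>length p. edge_cost n (?g k))"
    by (intro sum.group) (auto simp: all_edges_def finite_edges_in)
  moreover have "travel_cost n (edge_multiplicity p)
      = (\<Sum>e\<in>all_edges n. \<Sum>k\<in>{k \<in> {..length p}. ?g k = e}. edge_cost n (?g k))"
    unfolding travel_cost_def edge_multiplicity_alt by (intro sum.cong) (simp_all add: mult.commute)
  ultimately have "travel_cost n (edge_multiplicity p) = (\<Sum>k\<le>length p. edge_cost n (?g k))"
    by simp
  also obtain m where m: "length p = Suc m"
    using len by (cases "length p") auto
  have "(\<Sum>k\<le>length p. edge_cost n (?g k))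
      = edge_cost n (?g 0) + (\<Sum>j<m. edge_cost n (?g (Suc j))) + edge_cost n (?g (Suc m))"
    unfolding m by (subst sum.atMost_Suc, subst sum.atMost_shift) (rule refl)
  also have "edge_cost n (?g 0) = 1"
    by (simp add: edge_cost_def)
  also have "edge_cost n (?g (Suc m)) = 1"
    using nth_route[of "length p + 1" p] m by (simp add: edge_cost_def)
  also have "(\<Sum>j<m. edge_cost n (?g (Suc j))) = (\<Sum>j<m. edge_cost n {p ! j, p ! (j + 1)})"
    by (intro sum.cong) (auto simp: m nth_append)
  also have "\<dots> = (\<Sum>e\<in>path_edges p. edge_cost n e)"
    unfolding path_edges_def by (subst sum.reindex[OF inj_on_path_edge[OF assms(1)]]) (simp add: m)
  finally show ?thesis
    by simp
qed

lemma zero_notin_path_edge: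
  assumes "set p \<subseteq> customers n" "e \<in> path_edges p"
  shows "0 \<notin> e"
proof -
  obtain j where j: "j < length p - 1" "e = {p ! j, p ! (j + 1)}"
    using assms(2) by (auto simp: path_edges_def)
  then have "p ! j \<in> set p" "p ! (j + 1) \<in> set p"
    by auto
  then show ?thesis
    using assms(1) j(2) by (auto simp: customers_def)
qed

lemma finite_path_edges [simp]: "finite (path_edges p)"
  by (simp add: path_edges_def)


section \<open>The rim\<close>

text \<open>Each rim edge is indexed by the endpoint at which a walk around the cycle enters
  it.\<close>

lemma rim_edges_alt:
  assumes "n \<ge> 1"
  shows "rim_edges n = (\<lambda>k. {k, if k = n then 1 else k + 1}) ` {1..n}"
  unfolding rim_edges_def using assms by (force simp: image_iff)

text \<open>For \<open>n = 2\<close> the two indices would give the same edge.\<close>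

lemma inj_on_rim_edge:
  fixes n :: nat
  assumes "n \<ge> 3"
  shows "inj_on (\<lambda>k. {k, if k = n then 1 else k + 1}) {1..n}"
  using assms by (auto simp: inj_on_def doubleton_eq_iff)

lemma card_rim_edges: "n \<ge> 3 \<Longrightarrow> card (rim_edges n) = n"
  by (simp only: rim_edges_alt card_image inj_on_rim_edge) simp

lemma finite_rim_edges: "n \<ge> 1 \<Longrightarrow> finite (rim_edges n)"
  by (simp add: rim_edges_alt)

lemma rim_path_avoiding_edge:
  assumes "n \<ge> 3" "e \<in> rim_edges n"
  obtains p where "distinct p" "set p = customers n" "path_edges p \<subseteq> rim_edges n - {e}"
proof -
  let ?r = "\<lambda>k. {k, if k = n then 1 else k + 1}"
  obtain k where k: "k \<in> {1..n}" "e = ?r k"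
    using assms by (auto simp: rim_edges_alt)
  \<comment> \<open>The cycle is cut at \<open>e\<close>: the walk starts just after
    \<open>k\<close>, goes once around and ends at \<open>k\<close>.\<close>
  define p where "p = [k + 1..<n + 1] @ [1..<k + 1]"
  have "distinct p" "set p = customers n"
    using k by (auto simp: p_def customers_def)
  have len: "length p = n"
    using k by (simp add: p_def del: upt_Suc)
  have nth: "p ! j = (if j < n - k then k + 1 + j else j - (n - k) + 1)" if "j < n" for j
    using k that by (simp add: p_def nth_append del: upt_Suc)
  have "{p ! j, p ! (j + 1)} \<in> rim_edges n - {e}" if j: "j < n - 1" for j
  proof -
    let ?i = "p ! j"
    have i: "?i \<in> {1..n}" "?i \<noteq> k"
      using k j by (auto simp: nth)
    moreover have "p ! (j + 1) = (if ?i = n then 1 else ?i + 1)"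
      using k j by (auto simp: nth)
    \<comment> \<open>Only the last vertex of the walk is \<open>k\<close>, so no step leaves from
      it, and distinct starting points give distinct rim edges.\<close>
    moreover have "?r ?i \<noteq> ?r k"
      using inj_onD[OF inj_on_rim_edge[OF assms(1)] _ i(1) k(1)] i(2) by blast
    moreover have "?r ?i \<in> rim_edges n"
      using i(1) assms(1) by (subst rim_edges_alt) (simp, rule imageI)
    ultimately show ?thesis
      using k(2) by simp
  qed
  then have "path_edges p \<subseteq> rim_edges n - {e}"
    unfolding path_edges_def len by blast
  then show thesis
    using that \<open>distinct p\<close> \<open>set p = customers n\<close> by blast
qed

lemma sum_edge_cost_rim:
  assumes "set p \<subseteq> customers n" "distinct p" "path_edges p \<subseteq> rim_edges n"
  shows "(\<Sum>e\<in>path_edges p. edge_cost n e) = real (length p - 1)"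
proof -
  have "(\<Sum>e\<in>path_edges p. edge_cost n e) = (\<Sum>e\<in>path_edges p. 1)"
    using assms zero_notin_path_edge by (intro sum.cong) (auto simp: edge_cost_def)
  then show ?thesis
    using card_path_edges[OF assms(2)] by simp
qed

lemma sum_edge_cost_not_rim:
  assumes "set p \<subseteq> customers n" "distinct p" "\<not> path_edges p \<subseteq> rim_edges n"
  shows "(\<Sum>e\<in>path_edges p. edge_cost n e) > real (length p - 1)"
proof -
  obtain e where e: "e \<in> path_edges p" "e \<notin> rim_edges n"
    using assms(3) by blast
  have "(\<Sum>e\<in>path_edges p. 1) < (\<Sum>e\<in>path_edges p. edge_cost n e)"
  proof (rule sum_strict_mono_ex1)
    show "\<exists>e\<in>path_edges p. 1 < edge_cost n e"
      using e zero_notin_path_edge[OF assms(1) e(1)] by (auto simp: edge_cost_def)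
  qed (auto simp: edge_cost_def)
  then show ?thesis
    using card_path_edges[OF assms(2)] by simp
qed


section \<open>Cuts and optimal values\<close>

lemma optimal_value_gt:
  assumes "n \<ge> 4" "0 < \<mu>" "\<mu> < 1" "f \<ge> real n * \<mu> / real_of_int (capacity n)"
  shows "optimal_value n \<mu> f > real n + 1"
proof -
  have "feasible_routes n \<mu> f \<subseteq> {p. set p \<subseteq> customers n \<and> distinct p}"
    by (auto simp: feasible_routes_def feasible_path_def)
  then have fin: "finite (feasible_routes n \<mu> f)"
    by (rule finite_subset) (intro finite_subset_distinct finite_customers)
  have "feasible_path n \<mu> f [1..<n + 1]"
    using assms by (intro feasible_pathI) (auto simp: customers_def)
  then have ne: "feasible_routes n \<mu> f \<noteq> {}"
    by (auto simp: feasible_routes_def customers_def intro!: exI[of _ "[1..<n + 1]"])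
  have "travel_cost n (edge_multiplicity p) + recourse_OR n \<mu> p > real n + 1"
    if "p \<in> feasible_routes n \<mu> f" for p
  proof -
    have p: "p \<noteq> []" "distinct p" "set p = customers n"
      using that by (auto simp: feasible_routes_def feasible_path_def)
    have len: "length p = n"
      using p distinct_card by fastforce
    show ?thesis
    proof (cases "path_edges p \<subseteq> rim_edges n")
      case True
      then have "recourse_OR n \<mu> p > 0"
        using assms p len by (intro recourse_OR_rim_pos) (auto simp: path_edges_subset_iff_successively)
      then show ?thesis
        using assms p len True travel_cost_route[of p n] sum_edge_cost_rim[of p n] by simp
    next
      case False
      then show ?thesis
        using assms p len travel_cost_route[of p n] sum_edge_cost_not_rim[of p n]
          recourse_OR_nonneg[of n \<mu> p] by simp
    qed
  qed
  \<comment> \<open>The minimum over finitely many routes is attained, so the strict bound passes to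
    it.\<close>
  then show ?thesis
    unfolding optimal_value_def using fin ne by (subst Min_gr_iff) auto
qed

lemma exists_path_recourse_0:
  assumes "n \<ge> 4" "0 < \<mu>" "\<mu> < 1" "S \<subseteq> customers n"
  obtains p where "distinct p" "set p = S" "recourse_OR n \<mu> p = 0"
proof (cases "S = customers n")
  case True
  \<comment> \<open>Swapping 2 and 3 in the natural order creates the edge \<open>{1, 3}\<close>,
    which lies off the rim as soon as \<open>n \<ge> 4\<close>.\<close>
  let ?p = "1 # 3 # 2 # [4..<n + 1]"
  have "{1, 3} \<notin> rim_edges n"
    using assms by (auto simp: rim_edges_def doubleton_eq_iff)
  then have "recourse_OR n \<mu> ?p = 0"
    using assms by (intro recourse_OR_not_rim) (auto simp: customers_def)
  moreover have "set ?p = S"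
    using assms True by (auto simp: customers_def)
  ultimately show thesis
    using that[of ?p] by auto
next
  case False
  then have "card S < n"
    using assms psubset_card_mono[of "customers n" S] by auto
  moreover obtain p where "distinct p" "set p = S"
    using finite_distinct_list finite_subset[OF assms(4)] by auto
  ultimately show thesis
    using that[of p] assms recourse_OR_short[of n \<mu> p] distinct_card by fastforce
qed

text \<open>A zero-recourse path through all of \<open>S\<close> is by itself a partition into one
  path. It forces \<open>m = 1\<close> and bounds \<open>L\<close> by 0 from above.\<close>

lemma S_cut_coefficient_0:
  assumes "n \<ge> 4" "0 < \<mu>" "\<mu> < 1" "f \<ge> real n * \<mu> / real_of_int (capacity n)"
    and "valid_cut n \<mu> f (S_cut S L m)"
  shows "L = 0"
proof -
  have S: "S \<noteq> {}" "S \<subseteq> customers n"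
    using assms(5) by auto
  obtain p where p: "distinct p" "set p = S" "recourse_OR n \<mu> p = 0"
    using exists_path_recourse_0 assms S by blast
  have "feasible_path n \<mu> f p"
    using p S assms by (intro feasible_pathI) auto
  then have mem: "{p} \<in> path_partitions n \<mu> f S 1"
    using p by (simp add: path_partitions_def disjoint_family_on_def)
  then have "min_paths n \<mu> f S \<le> 1"
    unfolding min_paths_def by (intro Least_le) blast
  then have "m = 1"
    using assms(5) by simp
  have "path_partitions n \<mu> f S 1 \<subseteq> Pow {p. set p \<subseteq> customers n \<and> distinct p}"
    by (auto simp: path_partitions_def feasible_path_def)
  then have "finite (path_partitions n \<mu> f S 1)"
    by (rule finite_subset) (intro finite_Pow_iff[THEN iffD2] finite_subset_distinct finite_customers)
  then have "recourse_bound n \<mu> f S 1 \<le> (\<Sum>p\<in>{p}. recourse_OR n \<mu> p)"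
    unfolding recourse_bound_def using mem by (intro Min_le) blast+
  then show ?thesis
    using assms(5) p(3) \<open>m = 1\<close> by simp
qed

text \<open>Either the recourse of \<open>p\<close> vanishes, or \<open>p\<close> uses
  \<open>e\<close>. In the latter case \<open>p'\<close> shares at most \<open>n - 2\<close> of the
  \<open>n - 1\<close> edges of \<open>p\<close>, so the factor in the cut is at most
  \<open>(n - 2) - n + 2 = 0\<close>.\<close>

lemma P_cut_satisfied:
  assumes "n \<ge> 4" "0 < \<mu>" "\<mu> < 1" "feasible_path n \<mu> f p"
    and "distinct p'" "e \<notin> path_edges p'"
    and "length p = n \<Longrightarrow> path_edges p \<subseteq> rim_edges n \<Longrightarrow> e \<in> path_edges p"
  shows "satisfies_cut n \<mu> (edge_multiplicity p') (\<lambda>_. 0) (P_cut p)"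
proof -
  have p: "distinct p" "set p \<subseteq> customers n"
    using assms(4) by (auto simp: feasible_path_def)
  have len: "length p \<le> n"
    using p card_mono[OF finite_customers p(2)] distinct_card[of p] by simp
  show ?thesis
  proof (cases "length p = n \<and> path_edges p \<subseteq> rim_edges n")
    case False
    then have "recourse_OR n \<mu> p = 0"
      using assms p len recourse_OR_short[of n \<mu> p] recourse_OR_not_rim[of n \<mu> p]
      by (cases "length p = n") (auto simp: path_edges_subset_iff_successively)
    then show ?thesis
      by simp
  next
    case True
    then have e: "e \<in> path_edges p"
      using assms by blast
    have "(\<Sum>j<length p - 1. real (edge_multiplicity p' {p ! j, p ! (j + 1)}))
        = (\<Sum>e\<in>path_edges p. real (edge_multiplicity p' e))"
      unfolding path_edges_def by (subst sum.reindex[OF inj_on_path_edge[OF p(1)]]) simp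
    also have "\<dots> = (\<Sum>e\<in>path_edges p. of_bool (e \<in> path_edges p'))"
      using assms(5) zero_notin_path_edge[OF p(2)] edge_multiplicity_interior
      by (intro sum.cong) auto
    also have "\<dots> = (\<Sum>e\<in>path_edges p - {e}. of_bool (e \<in> path_edges p'))"
      using assms(6) e by (subst sum.remove[of _ e]) auto
    also have "\<dots> \<le> (\<Sum>e\<in>path_edges p - {e}. 1)"
      by (intro sum_mono) auto
    also have "\<dots> = real n - 2"
      using assms(1) e card_path_edges[OF p(1)] True by simp
    finally have "(\<Sum>j<length p - 1. real (edge_multiplicity p' {p ! j, p ! (j + 1)}))
        - real (card (set p)) + 2 \<le> 0"
      using distinct_card[OF p(1)] True by simp
    then show ?thesis
      using recourse_OR_nonneg[of n \<mu> p] by (simp add: mult_nonneg_nonpos)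
  qed
qed

text \<open>A Hamiltonian rim path has \<open>n - 1\<close> of the \<open>n\<close> rim edges, so
  each cut rules out at most one edge, and fewer than \<open>n\<close> cuts leave one.\<close>

lemma exists_rim_edge_covered:
  assumes "n \<ge> 3" "finite C" "card C < n"
    and "\<And>p. P_cut p \<in> C \<Longrightarrow> distinct p"
  obtains e where "e \<in> rim_edges n"
    and "\<And>p. P_cut p \<in> C \<Longrightarrow> length p = n \<Longrightarrow> path_edges p \<subseteq> rim_edges n \<Longrightarrow> e \<in> path_edges p"
proof -
  \<comment> \<open>These are the edges that the sought route must not skip: skipping the one edge
    missed by \<open>p\<close> would make the route run along \<open>p\<close> itself, where its cut
    binds. S-cuts exclude nothing, as their coefficient is 0.\<close>
  define missed where "missed = (\<lambda>c. case c of
      P_cut p \<Rightarrow> if length p = n \<and> path_edges p \<subseteq> rim_edges n then rim_edges n - path_edges p else {}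
    | S_cut _ _ _ \<Rightarrow> {})"
  have "card (missed c) \<le> 1" if "c \<in> C" for c
  proof (cases c)
    case (P_cut p)
    then have "card (path_edges p) = length p - 1"
      using assms(4) that card_path_edges by auto
    then show ?thesis
      using P_cut assms(1) by (auto simp: missed_def card_Diff_subset card_rim_edges)
  qed (simp add: missed_def)
  then have "card (\<Union>c\<in>C. missed c) \<le> card C"
    using card_UN_le[OF assms(2), of missed] sum_mono[of C "\<lambda>c. card (missed c)" "\<lambda>_. 1"] by simp
  then have "card (\<Union>c\<in>C. missed c) < card (rim_edges n)"
    using assms by (simp add: card_rim_edges)
  moreover have "finite (\<Union>c\<in>C. missed c)"
    using assms by (auto simp: missed_def finite_rim_edges split: cut.splits)
  ultimately obtain e where e: "e \<in> rim_edges n" "e \<notin> (\<Union>c\<in>C. missed c)"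
    by (meson card_mono linorder_not_less subsetI)
  have "e \<in> path_edges p" if "P_cut p \<in> C" "length p = n" "path_edges p \<subseteq> rim_edges n" for p
  proof -
    have "e \<notin> missed (P_cut p)"
      using e(2) that(1) by blast
    then show ?thesis
      using e(1) that(2,3) by (simp add: missed_def)
  qed
  then show thesis
    using e(1) that by blast
qed

theorem theorem7:
  fixes n :: nat and \<mu> f :: real and C :: "cut set"
  assumes "n \<ge> 4"
    and "0 < \<mu>" and "\<mu> < 1"
    and "f \<ge> real n * \<mu> / real_of_int (capacity n)"
    and "finite C" and "card C < n"
    and "\<forall>c\<in>C. valid_cut n \<mu> f c"
  shows "RMP_value n \<mu> f C < ereal (optimal_value n \<mu> f)"
proof -
  have feas: "feasible_path n \<mu> f p" if "P_cut p \<in> C" for p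
    using assms(7) that by fastforce
  then obtain e where e: "e \<in> rim_edges n"
    "\<And>p. P_cut p \<in> C \<Longrightarrow> length p = n \<Longrightarrow> path_edges p \<subseteq> rim_edges n \<Longrightarrow> e \<in> path_edges p"
    using exists_rim_edge_covered[of n C] assms by (auto simp: feasible_path_def)
  \<comment> \<open>The route skips exactly the rim edge that every P-cut path with positive
    recourse uses.\<close>
  obtain p' where p': "distinct p'" "set p' = customers n" "path_edges p' \<subseteq> rim_edges n - {e}"
    using rim_path_avoiding_edge[of n e] assms(1) e(1) by auto
  have len: "length p' = n"
    using p' distinct_card by fastforce
  then have "p' \<noteq> []"
    using assms(1) by auto
  have "satisfies_cut n \<mu> (edge_multiplicity p') (\<lambda>_. 0) c" if "c \<in> C" for c
  proof (cases c)
    case (P_cut p)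
    then show ?thesis
      using P_cut_satisfied[of n \<mu> f p p' e] feas e(2) p' assms(1-3) that by auto
  next
    case (S_cut S L m)
    moreover have "L = 0"
      using S_cut_coefficient_0 assms S_cut that by metis
    ultimately show ?thesis
      by simp
  qed
  moreover have "edge_multiplicity p' \<in> feasible_solutions n \<mu> f"
    using p' \<open>p' \<noteq> []\<close> feasible_pathI[OF assms(1-4), of p']
    by (auto simp: feasible_solutions_def feasible_routes_def)
  ultimately have "(edge_multiplicity p', \<lambda>_. 0) \<in> RMP_feasible n \<mu> f C"
    by (simp add: RMP_feasible_def)
  then have "RMP_value n \<mu> f C \<le> ereal (travel_cost n (edge_multiplicity p'))"
    unfolding RMP_value_def by (rule INF_lower2) simp
  \<comment> \<open>There are \<open>n - 1\<close> rim edges and two depot legs, each of cost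
    1.\<close>
  also have "travel_cost n (edge_multiplicity p') = real n + 1"
    using travel_cost_route[of p' n] sum_edge_cost_rim[of p' n] p' len \<open>p' \<noteq> []\<close> assms(1)
    by (auto simp: subset_Diff_insert)
  also have "ereal (real n + 1) < ereal (optimal_value n \<mu> f)"
    using optimal_value_gt[OF assms(1-4)] by simp
  finally show ?thesis .
qed

end
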